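(* Let $N\ge 1$. Among all sets $\mathcal{I}\subseteq\mathfrak{S}_N$ (without repeated elements) that define a strategy-indifferent game of best choice, the largest possible value of $|\mathcal{I}|$ is $$(N-1)!\left(1+\sum_{i=1}^{N-1}\frac1i\right).$$ This value is attained by the strategy-indifferent set $\mathcal{I}$ of all permutations obtained by taking some $\tau\in\mathfrak{S}_{N-1}$ and inserting the value $N$ into $\tau$ so that it occupies position $i$, where either $i=N$ or $i$ is the position of a left-to-right maximum of $\tau$ (the entries of $\tau$ keeping their relative order).
   Context: $\mathfrak{S}_N$ is the set of permutations of $\{1,\dots,N\}$ in one-line notation ($\mathfrak{S}_0$ consists of the empty permutation). The flattening of a sequence of $i$ distinct integers is the unique permutation of $\{1,\dots,i\}$ with the same relative order. For a permutation $\pi$, $\pi|_{[i]}$ denotes the flattening of $\pi_1,\dots,\pi_i$. Game of best choice defined by a nonempty set $\mathcal{I}\subseteq\mathfrak{S}_N$: $\pi\in\mathcal{I}$ is chosen uniformly at random, and $\pi|_{[1]},\pi|_{[2]},\dots$ are presented sequentially to the player, who may stop at one position. The player wins if they stop at position $i$ with $\pi_i=N$, and loses otherwise. A strategy is given by a strike set $A$ of prefixes: the player stops at the first $i$ for which $\pi|_{[i]}\in A$ (and loses if there is no such $i$). An entry $\pi_j$ is a left-to-right maximum if $\pi_i<\pi_j$ for all $i<j$. A permutation in $\bigcup_{i=1}^N\mathfrak{S}_i$ is an eligible prefix if its last entry is a left-to-right maximum. The prefix tree $\mathcal{P}_N$ is the set of all eligible prefixes in $\bigcup_{i=1}^N\mathfrak{S}_i$,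 partially ordered by containment: $q$ contains $p$ if $q|_{[i]}=p$, where $i$ is the size of $p$. A maximal antichain in $\mathcal{P}_N$ is a subset $A\subseteq\mathcal{P}_N$ with no two distinct elements comparable and such that every element of $\mathcal{P}_N$ contains or is contained in some element of $A$. $\mathcal{I}$ is strategy-indifferent if every strike set that is a maximal antichain in $\mathcal{P}_N$ has the same probability of winning the game defined by $\mathcal{I}$. *)

theory Defs
  imports "HOL-Probability.Probability_Mass_Function" "HOL-Combinatorics.Multiset_Permutations"
begin

text \<open>
  Permutations are lists in one-line notation. Positions are numbered from 1, so the entry
  \<open>\<pi>\<^sub>i\<close> is \<open>\<pi> ! (i - 1)\<close>.
\<close>

abbreviation perms :: "nat \<Rightarrow> nat list set" where
  "perms N \<equiv> permutations_of_set {1..N}"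

definition flatten :: "nat list \<Rightarrow> nat list" where
  "flatten xs = (THE \<sigma>. \<sigma> \<in> perms (length xs) \<and>
     (\<forall>i<length xs. \<forall>j<length xs. \<sigma> ! i < \<sigma> ! j \<longleftrightarrow> xs ! i < xs ! j))"

definition restr :: "nat list \<Rightarrow> nat \<Rightarrow> nat list" where
  "restr \<pi> i = flatten (take i \<pi>)"

definition lr_max :: "nat list \<Rightarrow> nat \<Rightarrow> bool" where
  "lr_max \<pi> j \<longleftrightarrow> j \<in> {1..length \<pi>} \<and> (\<forall>i\<in>{1..<j}. \<pi> ! (i - 1) < \<pi> ! (j - 1))"

definition prefix_tree :: "nat \<Rightarrow> nat list set" where
  "prefix_tree N = {p. p \<in> (\<Union>i\<in>{1..N}. perms i) \<and> lr_max p (length p)}"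

definition contains :: "nat list \<Rightarrow> nat list \<Rightarrow> bool" where
  "contains q p \<longleftrightarrow> length p \<le> length q \<and> restr q (length p) = p"

definition maximal_antichain :: "nat \<Rightarrow> nat list set \<Rightarrow> bool" where
  "maximal_antichain N A \<longleftrightarrow>
     A \<subseteq> prefix_tree N \<and>
     (\<forall>p\<in>A. \<forall>q\<in>A. p \<noteq> q \<longrightarrow> \<not> contains p q \<and> \<not> contains q p) \<and>
     (\<forall>q\<in>prefix_tree N. \<exists>p\<in>A. contains q p \<or> contains p q)"

definition wins :: "nat \<Rightarrow> nat list set \<Rightarrow> nat list \<Rightarrow> bool" where
  "wins N A \<pi> \<longleftrightarrow>
     (\<exists>i\<in>{1..N}. restr \<pi> i \<in> A \<and> (\<forall>j\<in>{1..<i}. restr \<pi> j \<notin> A) \<and> \<pi> ! (i - 1) = N)"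

definition win_prob :: "nat \<Rightarrow> nat list set \<Rightarrow> nat list set \<Rightarrow> real" where
  "win_prob N I A = measure_pmf.prob (pmf_of_set I) {\<pi>. wins N A \<pi>}"

definition strategy_indifferent :: "nat \<Rightarrow> nat list set \<Rightarrow> bool" where
  "strategy_indifferent N I \<longleftrightarrow>
     I \<noteq> {} \<and> I \<subseteq> perms N \<and>
     (\<forall>A B. maximal_antichain N A \<longrightarrow> maximal_antichain N B \<longrightarrow> win_prob N I A = win_prob N I B)"

definition insert_at :: "nat \<Rightarrow> nat \<Rightarrow> nat list \<Rightarrow> nat list" where
  "insert_at i x \<tau> = take (i - 1) \<tau> @ [x] @ drop (i - 1) \<tau>"

definition extremal_set :: "nat \<Rightarrow> nat list set" where
  "extremal_set N = {insert_at i N \<tau> | i \<tau>. \<tau> \<in> perms (N - 1) \<and> (i = N \<or> lr_max \<tau> i)}"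

lemma order_iso_perm_unique:
  assumes "\<sigma> \<in> perms n" "\<tau> \<in> perms n"
    and "\<forall>i<n. \<forall>j<n. \<sigma> ! i < \<sigma> ! j \<longleftrightarrow> \<tau> ! i < \<tau> ! j"
  shows "\<sigma> = \<tau>"
proof -
  have rank: "\<rho> ! i = card {j. j < n \<and> \<rho> ! j < \<rho> ! i} + 1" if r: "\<rho> \<in> perms n" and i: "i < n" for \<rho> i
  proof -
    have s: "set \<rho> = {1..n}" and d: "distinct \<rho>"
      using r by (auto simp: permutations_of_set_def)
    have l: "length \<rho> = n" using s d distinct_card by fastforce
    have "(!) \<rho> ` {j. j < n \<and> \<rho> ! j < \<rho> ! i} = {x \<in> set \<rho>. x < \<rho> ! i}"
      using l by (auto simp: in_set_conv_nth)
    also have "\<dots> = {1..<\<rho> ! i}"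
      using s l i nth_mem[of i \<rho>] by auto
    finally have "card {1..<\<rho> ! i} = card ((!) \<rho> ` {j. j < n \<and> \<rho> ! j < \<rho> ! i})" by simp
    also have "\<dots> = card {j. j < n \<and> \<rho> ! j < \<rho> ! i}"
      by (rule card_image) (use d l in \<open>auto simp: inj_on_def nth_eq_iff_index_eq\<close>)
    finally show ?thesis using s l i nth_mem[of i \<rho>] by auto
  qed
  have l: "length \<sigma> = n" "length \<tau> = n"
    using assms(1,2) length_finite_permutations_of_set by fastforce+
  show ?thesis
  proof (rule nth_equalityI)
    fix i assume "i < length \<sigma>"
    then have i: "i < n" using l by simp
    have "{j. j < n \<and> \<sigma> ! j < \<sigma> ! i} = {j. j < n \<and> \<tau> ! j < \<tau> ! i}" using assms(3) i by blast
    then show "\<sigma> ! i = \<tau> ! i" using rank[OF assms(1) i] rank[OF assms(2) i] by simp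
  qed (use l in simp)
qed

lemma flatten_eq:
  assumes "distinct xs"
  shows "flatten xs = map (\<lambda>x. card {y \<in> set xs. y \<le> x}) xs"
proof -
  let ?r = "\<lambda>x. card {y \<in> set xs. y \<le> x}"
  have mono: "?r x < ?r y" if "x < y" "y \<in> set xs" for x y
  proof (rule psubset_card_mono)
    have "{z \<in> set xs. z \<le> x} \<subseteq> {z \<in> set xs. z \<le> y}" using that by auto
    moreover have "y \<in> {z \<in> set xs. z \<le> y} - {z \<in> set xs. z \<le> x}" using that by auto
    ultimately show "{z \<in> set xs. z \<le> x} \<subset> {z \<in> set xs. z \<le> y}" by blast
  qed simp
  have less: "?r x < ?r y \<longleftrightarrow> x < y" if "x \<in> set xs" "y \<in> set xs" for x y
    using mono[of x y] mono[of y x] that by (cases x y rule: linorder_cases) simp_all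
  have inj: "inj_on ?r (set xs)"
  proof (rule inj_onI)
    fix x y assume "x \<in> set xs" "y \<in> set xs" "?r x = ?r y"
    then have "\<not> x < y" "\<not> y < x" using less[of x y] less[of y x] by auto
    then show "x = y" by simp
  qed
  have "?r ` set xs \<subseteq> {1..length xs}"
  proof (rule image_subsetI)
    fix x assume x: "x \<in> set xs"
    have "?r x \<le> card (set xs)" by (rule card_mono) auto
    moreover have "?r x \<noteq> 0" using x by (subst card_0_eq) auto
    ultimately show "?r x \<in> {1..length xs}"
      unfolding distinct_card[OF assms] atLeastAtMost_iff by linarith
  qed
  then have img: "?r ` set xs = {1..length xs}"
    by (rule card_subset_eq[rotated]) (simp_all add: card_image[OF inj] distinct_card[OF assms])
  have P: "map ?r xs \<in> perms (length xs)"
    using img inj assms by (auto simp: permutations_of_set_def distinct_map)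
  have O: "\<forall>i<length xs. \<forall>j<length xs. map ?r xs ! i < map ?r xs ! j \<longleftrightarrow> xs ! i < xs ! j"
    by (simp add: less)
  show ?thesis unfolding flatten_def
  proof (rule the_equality)
    show "map ?r xs \<in> perms (length xs) \<and>
      (\<forall>i<length xs. \<forall>j<length xs. map ?r xs ! i < map ?r xs ! j \<longleftrightarrow> xs ! i < xs ! j)"
      using P O by blast
  next
    fix \<sigma> assume a: "\<sigma> \<in> perms (length xs) \<and>
      (\<forall>i<length xs. \<forall>j<length xs. \<sigma> ! i < \<sigma> ! j \<longleftrightarrow> xs ! i < xs ! j)"
    show "\<sigma> = map ?r xs"
      by (rule order_iso_perm_unique[OF _ P]) (use a O in auto)
  qed
qed

end

theory Submission
  imports Defs
begin

text \<open>
  Stopping at an eligible prefix \<open>p\<close> of size \<open>i\<close> wins for the \<open>\<pi> \<in> I\<close> with \<open>\<pi>|\<^bsub>[i]\<^esub> = p\<close> and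
  \<open>\<pi>\<^sub>i = N\<close>. Comparing the maximal antichain of all leaves (the \<open>\<pi>\<close> with \<open>\<pi>\<^sub>N = N\<close>) with the one
  consisting of \<open>p\<close> and the leaves not containing \<open>p\<close>, strategy-indifference forces this number to
  equal the number of leaves in \<open>I\<close> that contain \<open>p\<close>. Summing over all \<open>p\<close>, the size of \<open>I\<close> is the
  total number of left-to-right maxima of the leaves in \<open>I\<close>, which is largest when \<open>I\<close> contains
  every leaf \<open>\<tau>N\<close>.
  In the extremal set, for each \<open>\<tau>\<close> and each maximal antichain \<open>A\<close> exactly one insertion of \<open>N\<close>
  into \<open>\<tau>\<close> wins, namely at the size of the unique prefix of the leaf \<open>\<tau>N\<close> in \<open>A\<close>; so every
  \<open>A\<close> wins for exactly \<open>(N - 1)!\<close> elements.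
\<close>

subsection \<open>Flattening\<close>

lemma perms_length: "\<sigma> \<in> perms n \<Longrightarrow> length \<sigma> = n"
  using length_finite_permutations_of_set by fastforce

lemma perms_distinct: "\<sigma> \<in> perms n \<Longrightarrow> distinct \<sigma>"
  by (auto simp: permutations_of_set_def)

lemma perms_nth: "\<sigma> \<in> perms n \<Longrightarrow> i < n \<Longrightarrow> \<sigma> ! i \<in> {1..n}"
  using nth_mem[of i \<sigma>] perms_length[of \<sigma> n] by (auto simp: permutations_of_set_def)

text \<open>Flattening replaces each entry by its rank (\<open>flatten_eq\<close>). The rank is
  strictly monotone on the entries, hence a bijection onto \<open>{1..length xs}\<close>. Later
  proofs rely on these two properties instead of the definite description.\<close>

lemma flatten_spec:
  assumes "distinct xs"
  shows "flatten xs \<in> perms (length xs)"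
    and "i < length xs \<Longrightarrow> j < length xs \<Longrightarrow> flatten xs ! i < flatten xs ! j \<longleftrightarrow> xs ! i < xs ! j"
proof -
  let ?r = "\<lambda>x. card {y \<in> set xs. y \<le> x}"
  have mono: "?r x < ?r y" if "x < y" "y \<in> set xs" for x y
  proof (rule psubset_card_mono)
    have "y \<in> {z \<in> set xs. z \<le> y} - {z \<in> set xs. z \<le> x}" using that by auto
    moreover have "{z \<in> set xs. z \<le> x} \<subseteq> {z \<in> set xs. z \<le> y}" using that by auto
    ultimately show "{z \<in> set xs. z \<le> x} \<subset> {z \<in> set xs. z \<le> y}" by blast
  qed simp
  have less: "?r x < ?r y \<longleftrightarrow> x < y" if "x \<in> set xs" "y \<in> set xs" for x y
    using mono[of x y] mono[of y x] that by (cases x y rule: linorder_cases) simp_all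
  have inj: "inj_on ?r (set xs)"
  proof (rule inj_onI)
    fix x y assume "x \<in> set xs" "y \<in> set xs" "?r x = ?r y"
    then have "\<not> x < y" "\<not> y < x" using less[of x y] less[of y x] by auto
    then show "x = y" by simp
  qed
  have "?r ` set xs \<subseteq> {1..length xs}"
  proof (rule image_subsetI)
    fix x assume x: "x \<in> set xs"
    have "?r x \<le> card (set xs)" by (rule card_mono) auto
    moreover have "?r x \<noteq> 0" using x by (subst card_0_eq) auto
    ultimately show "?r x \<in> {1..length xs}"
      unfolding distinct_card[OF assms] atLeastAtMost_iff by linarith
  qed
  then have "?r ` set xs = {1..length xs}"
    by (rule card_subset_eq[rotated]) (simp_all add: card_image[OF inj] distinct_card[OF assms])
  then show "flatten xs \<in> perms (length xs)"
    unfolding flatten_eq[OF assms] using inj assms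
    by (auto simp: permutations_of_set_def distinct_map)
  show "flatten xs ! i < flatten xs ! j \<longleftrightarrow> xs ! i < xs ! j" if "i < length xs" "j < length xs"
    using that by (simp add: flatten_eq[OF assms] less)
qed

lemma flatten_cong:
  assumes "distinct xs" "distinct ys" "length xs = length ys"
    and "\<And>i j. i < length xs \<Longrightarrow> j < length xs \<Longrightarrow> xs ! i < xs ! j \<longleftrightarrow> ys ! i < ys ! j"
  shows "flatten xs = flatten ys"
proof (rule order_iso_perm_unique)
  show "flatten xs \<in> perms (length xs)" using flatten_spec(1)[OF assms(1)] .
  show "flatten ys \<in> perms (length xs)" using flatten_spec(1)[OF assms(2)] unfolding assms(3) .
  show "\<forall>i<length xs. \<forall>j<length xs.
      flatten xs ! i < flatten xs ! j \<longleftrightarrow> flatten ys ! i < flatten ys ! j"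
    by (metis assms flatten_spec(2))
qed

lemma flatten_perms: "\<sigma> \<in> perms n \<Longrightarrow> flatten \<sigma> = \<sigma>"
  using order_iso_perm_unique[of "flatten \<sigma>" n \<sigma>] flatten_spec[of \<sigma>]
    perms_length[of \<sigma> n] perms_distinct[of \<sigma> n] by simp

lemma restr_perms: "\<sigma> \<in> perms n \<Longrightarrow> restr \<sigma> n = \<sigma>"
  using flatten_perms[of \<sigma> n] perms_length[of \<sigma> n] by (simp add: restr_def)

lemma restr_in_perms:
  assumes "distinct \<pi>" "i \<le> length \<pi>"
  shows "restr \<pi> i \<in> perms i"
  using flatten_spec(1)[of "take i \<pi>"] assms by (simp add: restr_def min_absorb2)

lemma restr_length:
  assumes "distinct \<pi>" "i \<le> length \<pi>"
  shows "length (restr \<pi> i) = i"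
  using restr_in_perms[OF assms] perms_length by blast

lemma restr_nth_less_iff:
  assumes "distinct \<pi>" "i \<le> length \<pi>" "k < i" "l < i"
  shows "restr \<pi> i ! k < restr \<pi> i ! l \<longleftrightarrow> \<pi> ! k < \<pi> ! l"
  using flatten_spec(2)[of "take i \<pi>" k l] assms by (simp add: restr_def)

text \<open>Flattening keeps all comparisons among the first \<open>i\<close> entries, hence among
  the first \<open>j\<close>. This is the transitivity behind containment.\<close>

lemma restr_restr:
  assumes "distinct \<pi>" "i \<le> length \<pi>" "j \<le> i"
  shows "restr (restr \<pi> i) j = restr \<pi> j"
  unfolding restr_def[of _ j]
proof (rule flatten_cong)
  show "distinct (take j (restr \<pi> i))"
    using restr_in_perms[OF assms(1,2)] perms_distinct distinct_take by blast
  fix k l assume kl: "k < length (take j (restr \<pi> i))" "l < length (take j (restr \<pi> i))"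
  then show "take j (restr \<pi> i) ! k < take j (restr \<pi> i) ! l \<longleftrightarrow> take j \<pi> ! k < take j \<pi> ! l"
    using restr_nth_less_iff[OF assms(1,2), of k l] assms(3)
    by (simp add: restr_length[OF assms(1,2)])
qed (use assms restr_length[OF assms(1,2)] in auto)

lemma lr_max_restr_iff:
  assumes "distinct \<pi>" "i \<le> length \<pi>"
  shows "lr_max (restr \<pi> i) i \<longleftrightarrow> lr_max \<pi> i"
proof -
  have "restr \<pi> i ! (k - 1) < restr \<pi> i ! (i - 1) \<longleftrightarrow> \<pi> ! (k - 1) < \<pi> ! (i - 1)"
    if "k \<in> {1..<i}" for k
    using restr_nth_less_iff[OF assms, of "k - 1" "i - 1"] that by auto
  then show ?thesis using assms(2) by (simp add: lr_max_def restr_length[OF assms])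
qed

subsection \<open>The prefix tree\<close>

lemma prefix_tree_iff:
  "p \<in> prefix_tree N \<longleftrightarrow> length p \<in> {1..N} \<and> p \<in> perms (length p) \<and> lr_max p (length p)"
proof -
  have "p \<in> (\<Union>i\<in>{1..N}. perms i) \<longleftrightarrow> length p \<in> {1..N} \<and> p \<in> perms (length p)"
    using perms_length[of p] by blast
  then show ?thesis by (simp only: prefix_tree_def mem_Collect_eq conj_assoc)
qed

lemma restr_in_prefix_tree_iff:
  assumes "\<pi> \<in> perms N" "i \<in> {1..N}"
  shows "restr \<pi> i \<in> prefix_tree N \<longleftrightarrow> lr_max \<pi> i"
proof -
  have "distinct \<pi>" "i \<le> length \<pi>" using assms perms_distinct perms_length by auto
  then show ?thesis
    using assms(2) restr_in_perms[of \<pi> i]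
    by (simp add: prefix_tree_iff restr_length lr_max_restr_iff)
qed

text \<open>The largest value exceeds everything before it, so every winning position carries an
  eligible prefix.\<close>

lemma lr_max_of_max:
  assumes "\<pi> \<in> perms N" "i \<in> {1..N}" "\<pi> ! (i - 1) = N"
  shows "lr_max \<pi> i"
proof -
  have "\<pi> ! (k - 1) < N" if "k \<in> {1..<i}" for k
  proof -
    have "\<pi> ! (k - 1) \<le> N" using perms_nth[OF assms(1), of "k - 1"] that assms(2) by auto
    moreover have "\<pi> ! (k - 1) \<noteq> \<pi> ! (i - 1)"
      using that assms(2) perms_length[OF assms(1)]
      by (subst nth_eq_iff_index_eq[OF perms_distinct[OF assms(1)]]) auto
    ultimately show ?thesis using assms(3) by simp
  qed
  then show ?thesis using assms perms_length[OF assms(1)] by (simp add: lr_max_def)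
qed

lemma leaf_iff:
  assumes "\<pi> \<in> perms N" "N \<ge> 1"
  shows "\<pi> \<in> prefix_tree N \<longleftrightarrow> \<pi> ! (N - 1) = N"
proof
  assume "\<pi> \<in> prefix_tree N"
  then have lr: "lr_max \<pi> N" by (simp add: prefix_tree_iff perms_length[OF assms(1)])
  have "N \<in> set \<pi>" using assms by (simp add: permutations_of_set_def)
  then obtain k where k: "k < N" "\<pi> ! k = N"
    using perms_length[OF assms(1)] by (auto simp: in_set_conv_nth)
  have "k = N - 1"
  proof (rule ccontr)
    assume "k \<noteq> N - 1"
    then have "k + 1 \<in> {1..<N}" using k by auto
    then have "\<pi> ! (k + 1 - 1) < \<pi> ! (N - 1)" using lr unfolding lr_max_def by blast
    moreover have "\<pi> ! (N - 1) \<le> N" using perms_nth[OF assms(1), of "N - 1"] assms(2) by auto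
    ultimately show False using k by simp
  qed
  then show "\<pi> ! (N - 1) = N" using k by simp
next
  assume "\<pi> ! (N - 1) = N"
  then show "\<pi> \<in> prefix_tree N"
    using lr_max_of_max[OF assms(1), of N] assms by (simp add: prefix_tree_iff perms_length)
qed

lemma prefix_extends_to_leaf:
  assumes "q \<in> prefix_tree N"
  obtains w where "w \<in> perms N" "w ! (N - 1) = N" "contains w q"
proof -
  define i where "i = length q"
  have q: "q \<in> perms i" "1 \<le> i" "i \<le> N" "lr_max q i"
    using assms by (auto simp: prefix_tree_iff i_def)
  \<comment> \<open>Appending the missing values in increasing order leaves the first
    \<open>i\<close> entries equal to \<open>q\<close> and puts \<open>N\<close> last. For
    \<open>i = N\<close> nothing is appended and \<open>q\<close> is itself a leaf.\<close>
  define w where "w = q @ [Suc i..<Suc N]"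
  have perm: "w \<in> perms N"
    using q by (auto simp: w_def permutations_of_set_def)
  have restr: "restr w i = q"
    using flatten_perms[OF q(1)] by (simp add: restr_def w_def i_def)
  have "w ! (N - 1) = N"
  proof (cases "i = N")
    case True
    then show ?thesis using assms leaf_iff[of q N] q by (simp add: w_def)
  next
    case False
    then have "\<not> N - 1 < i" "i + (N - 1 - i) = N - 1" using q(2,3) by auto
    then show ?thesis using q(2,3) False by (simp add: w_def nth_append i_def[symmetric] del: upt_Suc)
  qed
  then show thesis
    using that[of w] perm restr perms_length[OF perm] q(3) by (simp add: contains_def i_def)
qed

text \<open>The prefixes of one permutation are pairwise comparable, so an antichain contains at
  most one of them. The clause about stopping at the first hit is therefore automatic.\<close>

lemma wins_antichain_iff:
  assumes "maximal_antichain N A" "\<pi> \<in> perms N"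
  shows "wins N A \<pi> \<longleftrightarrow> (\<exists>i\<in>{1..N}. restr \<pi> i \<in> A \<and> \<pi> ! (i - 1) = N)"
proof -
  have "restr \<pi> j \<notin> A" if ij: "i \<in> {1..N}" "restr \<pi> i \<in> A" "j \<in> {1..<i}" for i j
  proof
    assume j: "restr \<pi> j \<in> A"
    have d: "distinct \<pi>" "i \<le> length \<pi>" "j \<le> length \<pi>" "j \<le> i"
      using ij assms(2) perms_distinct perms_length by auto
    have "restr \<pi> i \<noteq> restr \<pi> j"
      using arg_cong[of "restr \<pi> i" "restr \<pi> j" length] restr_length[OF d(1,2)]
        restr_length[OF d(1,3)] ij(3) by auto
    moreover have "contains (restr \<pi> i) (restr \<pi> j)"
      using d by (simp add: contains_def restr_length restr_restr)
    ultimately show False using assms(1) ij(2) j unfolding maximal_antichain_def by blast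
  qed
  then show ?thesis unfolding wins_def by blast
qed

lemma contains_restr_iff:
  assumes "\<pi> \<in> perms N"
  shows "contains \<pi> p \<longleftrightarrow> length p \<le> N \<and> restr \<pi> (length p) = p"
  using perms_length[OF assms] by (simp add: contains_def)

text \<open>By \<open>restr_restr\<close> the shorter prefix is a prefix of the longer one. This is
  what makes the containment order a tree.\<close>

lemma contains_common:
  assumes "distinct \<pi>" "contains \<pi> p" "contains \<pi> q"
  shows "contains p q \<or> contains q p"
  using restr_restr[OF assms(1), of "length p" "length q"]
    restr_restr[OF assms(1), of "length q" "length p"] assms(2,3) nat_le_linear[of "length p" "length q"]
  by (auto simp: contains_def)

text \<open>When \<open>p\<close> is a leaf, this set consists of all leaves, so one lemma yields
  both antichains that are compared for the upper bound.\<close>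

lemma leaves_maximal_antichain:
  assumes "p \<in> prefix_tree N"
  shows "maximal_antichain N (insert p {w \<in> perms N. w ! (N - 1) = N \<and> \<not> contains w p})"
    (is "maximal_antichain N ?A")
proof -
  have p: "length p \<in> {1..N}" "p \<in> perms (length p)" using assms by (auto simp: prefix_tree_iff)
  have full: "x = y" if "length x = N" "contains x y" "x \<in> ?A" "y \<in> perms N" for x y
  proof -
    have x: "x \<in> perms N" using that(1,3) p by auto
    show ?thesis
      using that(2) perms_length[OF that(4)] restr_perms[OF x] by (simp add: contains_def)
  qed
  have "?A \<subseteq> prefix_tree N" using assms leaf_iff p by auto
  moreover have "\<not> contains x y \<and> \<not> contains y x" if "x \<in> ?A" "y \<in> ?A" "x \<noteq> y" for x y
  proof -
    have *: "\<not> contains x y" if xy: "x \<in> ?A" "y \<in> ?A" "x \<noteq> y" for x y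
    proof (cases "y = p")
      case True
      then show ?thesis using xy by auto
    next
      \<comment> \<open>Here \<open>y\<close> has full size \<open>N\<close>, which forces
        \<open>x\<close> to have full size too, and then containment is equality.\<close>
      case False
      show ?thesis
      proof
        assume c: "contains x y"
        have y: "y \<in> perms N" using xy(2) False by auto
        have "length x \<le> N" using xy(1) p perms_length[of x N] by auto
        then have "length x = N" using c perms_length[OF y] by (simp add: contains_def)
        then show False using full[OF _ c xy(1) y] xy(3) by blast
      qed
    qed
    show ?thesis using *[of x y] *[of y x] that by blast
  qed
  moreover have "\<exists>x\<in>?A. contains q x \<or> contains x q" if q: "q \<in> prefix_tree N" for q
  proof -
    obtain w where l: "w \<in> perms N" "w ! (N - 1) = N" "contains w q"
      using prefix_extends_to_leaf[OF q] .
    show ?thesis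
    \<comment> \<open>If \<open>w\<close> contains \<open>p\<close>, then \<open>p\<close> and
      \<open>q\<close> are prefixes of the same leaf and thus comparable; otherwise \<open>w\<close>
      itself belongs to the set.\<close>
    proof (cases "contains w p")
      case True
      then show ?thesis using contains_common[OF perms_distinct[OF l(1)] True l(3)] by blast
    next
      case False
      then show ?thesis using l by blast
    qed
  qed
  ultimately show ?thesis unfolding maximal_antichain_def by blast
qed

lemma win_prob_eq:
  assumes "finite I" "I \<noteq> {}"
  shows "win_prob N I A = real (card {\<pi> \<in> I. wins N A \<pi>}) / real (card I)"
  using assms by (simp add: win_prob_def measure_pmf_of_set Int_def)

subsection \<open>The number of left-to-right maxima\<close>

text \<open>Splitting off the last entry, not the first, suits left-to-right maxima: appending an
  entry leaves the earlier ones unchanged.\<close>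

lemma permutations_of_set_snoc:
  assumes "A \<noteq> {}"
  shows "permutations_of_set A = (\<Union>x\<in>A. (\<lambda>ys. ys @ [x]) ` permutations_of_set (A - {x}))"
proof (intro equalityI subsetI)
  fix xs assume xs: "xs \<in> permutations_of_set A"
  then have "xs \<noteq> []" using assms by (auto simp: permutations_of_set_def)
  then have "xs = butlast xs @ [last xs]" by simp
  then obtain ys x where "xs = ys @ [x]" by blast
  then show "xs \<in> (\<Union>x\<in>A. (\<lambda>ys. ys @ [x]) ` permutations_of_set (A - {x}))"
    using xs by (auto simp: permutations_of_set_def)
next
  fix xs assume "xs \<in> (\<Union>x\<in>A. (\<lambda>ys. ys @ [x]) ` permutations_of_set (A - {x}))"
  then obtain x ys where "x \<in> A" "xs = ys @ [x]" "set ys = A - {x}" "distinct ys"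
    by (auto simp: permutations_of_set_def)
  then show "xs \<in> permutations_of_set A"
    by (simp add: permutations_of_set_def insert_absorb)
qed

lemma lr_max_snoc_iff:
  "lr_max (ys @ [x]) i \<longleftrightarrow> lr_max ys i \<or> i = Suc (length ys) \<and> (\<forall>y\<in>set ys. y < x)"
proof (cases "i = Suc (length ys)")
  case True
  \<comment> \<open>Writing the positions as an image under \<open>Suc\<close> turns positions
    counted from 1 into list indices counted from 0.\<close>
  have "lr_max (ys @ [x]) i \<longleftrightarrow> (\<forall>k\<in>Suc ` {..<length ys}. (ys @ [x]) ! (k - 1) < x)"
    using True by (simp add: lr_max_def image_Suc_lessThan atLeastLessThanSuc_atLeastAtMost)
  also have "\<dots> \<longleftrightarrow> (\<forall>y\<in>set ys. y < x)"
    by (auto simp: nth_append all_set_conv_all_nth)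
  finally show ?thesis using True by (simp add: lr_max_def)
next
  case False
  then show ?thesis by (auto simp: lr_max_def nth_append)
qed

lemma finite_lr_max: "finite {i. lr_max \<pi> i}"
  by (rule finite_subset[of _ "{1..length \<pi>}"]) (auto simp: lr_max_def)

lemma card_lr_max_snoc:
  "card {i. lr_max (ys @ [x]) i} = card {i. lr_max ys i} + (if \<forall>y\<in>set ys. y < x then 1 else 0)"
proof -
  have "Suc (length ys) \<notin> {i. lr_max ys i}" by (simp add: lr_max_def)
  moreover have "{i. lr_max (ys @ [x]) i} =
      (if \<forall>y\<in>set ys. y < x then insert (Suc (length ys)) {i. lr_max ys i} else {i. lr_max ys i})"
    by (auto simp: lr_max_snoc_iff)
  ultimately show ?thesis using finite_lr_max by simp
qed

text \<open>The last entry is a left-to-right maximum exactly when it is \<open>Max A\<close>, which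
  happens for n! of the (n+1)! permutations. So the total S satisfies S(n+1) = (n+1) S(n) + n!, and
  S(n)/n! is the harmonic number. The set \<open>A\<close> is arbitrary because deleting the last
  entry from an interval need not leave an interval.\<close>

lemma sum_card_lr_max:
  assumes "finite A" "card A = n"
  shows "(\<Sum>\<pi>\<in>permutations_of_set A. real (card {i. lr_max \<pi> i})) = fact n * (\<Sum>i=1..n. 1 / real i)"
  using assms
proof (induction n arbitrary: A)
  case 0
  then show ?case by (simp add: lr_max_def)
next
  case (Suc n)
  let ?c = "\<lambda>\<pi>. real (card {i. lr_max \<pi> i})"
  have ne: "A \<noteq> {}" using Suc.prems by auto
  have "(\<Sum>\<pi>\<in>permutations_of_set A. ?c \<pi>) =
      (\<Sum>x\<in>A. \<Sum>\<pi>\<in>(\<lambda>ys. ys @ [x]) ` permutations_of_set (A - {x}). ?c \<pi>)"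
    unfolding permutations_of_set_snoc[OF ne]
    by (rule sum.UNION_disjoint) (use Suc.prems in auto)
  also have "\<dots> = (\<Sum>x\<in>A. fact n * (\<Sum>i=1..n. 1 / real i) + (if x = Max A then fact n else 0))"
  proof (rule sum.cong[OF refl])
    fix x assume x: "x \<in> A"
    have cd: "card (A - {x}) = n" using Suc.prems x by simp
    have iff: "(\<forall>y\<in>set ys. y < x) \<longleftrightarrow> x = Max A" if "ys \<in> permutations_of_set (A - {x})" for ys
    proof -
      have s: "set ys = A - {x}" using that by (simp add: permutations_of_set_def)
      have "x = Max A \<longleftrightarrow> (\<forall>y\<in>A. y \<le> x)"
        using eq_Max_iff[OF Suc.prems(1) ne, of x] x by blast
      then show ?thesis using s by (auto simp: less_le)
    qed
    have "(\<Sum>\<pi>\<in>(\<lambda>ys. ys @ [x]) ` permutations_of_set (A - {x}). ?c \<pi>) =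
        (\<Sum>ys\<in>permutations_of_set (A - {x}). ?c (ys @ [x]))"
      by (subst sum.reindex) (auto simp: inj_on_def)
    also have "\<dots> = (\<Sum>ys\<in>permutations_of_set (A - {x}). ?c ys + (if x = Max A then 1 else 0))"
      by (rule sum.cong[OF refl]) (simp add: card_lr_max_snoc iff)
    also have "\<dots> = fact n * (\<Sum>i=1..n. 1 / real i) + (if x = Max A then fact n else 0)"
      using Suc.IH[of "A - {x}"] Suc.prems cd by (simp add: sum.distrib)
    finally show "(\<Sum>\<pi>\<in>(\<lambda>ys. ys @ [x]) ` permutations_of_set (A - {x}). ?c \<pi>) =
        fact n * (\<Sum>i=1..n. 1 / real i) + (if x = Max A then fact n else 0)" .
  qed
  also have "\<dots> = real (Suc n) * (fact n * (\<Sum>i=1..n. 1 / real i)) + fact n"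
    using Suc.prems ne by (simp add: sum.distrib)
  also have "\<dots> = fact (Suc n) * (\<Sum>i=1..Suc n. 1 / real i)"
    by (simp add: field_simps del: of_nat_Suc)
  finally show ?case .
qed

text \<open>The two cases in \<open>extremal_set\<close> merge: the admissible insertion positions
  are the left-to-right maxima of the leaf \<open>\<tau> @ [N]\<close>.\<close>

lemma lr_max_leaf_iff:
  assumes "\<tau> \<in> perms (N - 1)" "N \<ge> 1"
  shows "lr_max (\<tau> @ [N]) i \<longleftrightarrow> i = N \<or> lr_max \<tau> i"
proof -
  have "\<forall>y\<in>set \<tau>. y < N" "Suc (length \<tau>) = N"
    using assms perms_length[OF assms(1)] by (auto simp: permutations_of_set_def)
  then show ?thesis by (auto simp: lr_max_snoc_iff)
qed

text \<open>The final \<open>N\<close> adds one left-to-right maximum to each of the (N-1)! leaves,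
  which accounts for the summand 1 in the bound.\<close>

lemma sum_card_lr_max_leaves:
  assumes "N \<ge> 1"
  shows "(\<Sum>\<tau>\<in>perms (N - 1). real (card {i. lr_max (\<tau> @ [N]) i})) =
    fact (N - 1) * (1 + (\<Sum>i=1..N-1. 1 / real i))"
proof -
  have "\<forall>y\<in>set \<tau>. y < N" if "\<tau> \<in> perms (N - 1)" for \<tau>
    using assms that by (auto simp: permutations_of_set_def)
  then have "(\<Sum>\<tau>\<in>perms (N - 1). real (card {i. lr_max (\<tau> @ [N]) i})) =
      (\<Sum>\<tau>\<in>perms (N - 1). real (card {i. lr_max \<tau> i}) + 1)"
    by (intro sum.cong) (simp_all add: card_lr_max_snoc)
  also have "\<dots> = fact (N - 1) * (\<Sum>i=1..N-1. 1 / real i) + fact (N - 1)"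
    using sum_card_lr_max[of "{1..N-1}" "N - 1"] by (simp add: sum.distrib)
  finally show ?thesis by (simp add: algebra_simps)
qed

lemma leaves_eq:
  assumes "N \<ge> 1"
  shows "{\<pi> \<in> perms N. \<pi> ! (N - 1) = N} = (\<lambda>\<tau>. \<tau> @ [N]) ` perms (N - 1)" (is "?L = ?R")
proof -
  have *: "{1..N} - {N} = {1..N-1}" using assms by auto
  have "\<pi> \<in> ?R" if "\<pi> \<in> perms N" "\<pi> ! (N - 1) = N" for \<pi>
  proof -
    have "\<pi> \<in> (\<Union>x\<in>{1..N}. (\<lambda>ys. ys @ [x]) ` permutations_of_set ({1..N} - {x}))"
      using that(1) permutations_of_set_snoc[of "{1..N}"] assms by auto
    then obtain x ys where x: "\<pi> = ys @ [x]" "ys \<in> permutations_of_set ({1..N} - {x})" by blast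
    then have "x = N" using that perms_length[OF that(1)] by auto
    then show ?thesis using x * by auto
  qed
  moreover have "\<tau> @ [N] \<in> ?L" if "\<tau> \<in> perms (N - 1)" for \<tau>
    using that perms_length[OF that] assms by (auto simp: permutations_of_set_def nth_append)
  ultimately show ?thesis by blast
qed

subsection \<open>The upper bound\<close>

text \<open>The antichains \<open>L\<close> and \<open>B\<close> win on the same permutations among
  those without prefix \<open>p\<close>. Cancelling this common part from the equal numbers of wins
  leaves the permutations with prefix \<open>p\<close>, where \<open>B\<close> stops at
  \<open>i\<close> and \<open>L\<close> waits for position \<open>N\<close>.\<close>

lemma strategy_indifferent_prefix_count:
  assumes "strategy_indifferent N I" "p \<in> prefix_tree N" "length p = i"
  shows "card {\<pi> \<in> I. \<pi> ! (i - 1) = N \<and> restr \<pi> i = p} =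
    card {\<pi> \<in> I. \<pi> ! (N - 1) = N \<and> restr \<pi> i = p}"
proof (cases "i = N")
  case False
  have I: "I \<noteq> {}" "I \<subseteq> perms N" using assms(1) by (auto simp: strategy_indifferent_def)
  have fin: "finite I" using I(2) by (rule finite_subset) simp
  have i: "1 \<le> i" "i < N" using assms(2,3) False by (auto simp: prefix_tree_iff)
  define L where "L = {w \<in> perms N. w ! (N - 1) = N}"
  define B where "B = insert p {w \<in> perms N. w ! (N - 1) = N \<and> \<not> contains w p}"
  obtain w where l: "w \<in> perms N" "w ! (N - 1) = N"
    using prefix_extends_to_leaf[OF assms(2)] .
  \<comment> \<open>Any leaf \<open>w\<close> serves here: among permutations of full size
    containment is equality, so taking \<open>w\<close> as the distinguished prefix gives back the
    set of all leaves.\<close>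
  have "contains x w \<longleftrightarrow> x = w" if "x \<in> perms N" for x
    using that l(1) by (auto simp: contains_restr_iff perms_length restr_perms)
  then have "L = insert w {x \<in> perms N. x ! (N - 1) = N \<and> \<not> contains x w}"
    using l by (auto simp: L_def)
  then have mL: "maximal_antichain N L"
    using leaves_maximal_antichain[of w N] leaf_iff[OF l(1)] l(2) i by simp
  have mB: "maximal_antichain N B"
    unfolding B_def by (rule leaves_maximal_antichain[OF assms(2)])
  have len: "length (restr \<pi> j) = j" if "\<pi> \<in> perms N" "j \<le> N" for \<pi> j
    using that restr_length perms_distinct perms_length by blast
  have wL: "wins N L \<pi> \<longleftrightarrow> \<pi> ! (N - 1) = N" if "\<pi> \<in> perms N" for \<pi>
  proof -
    have "restr \<pi> j \<in> L \<longleftrightarrow> j = N \<and> \<pi> ! (N - 1) = N" if "j \<in> {1..N}" for j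
      using len[OF \<open>\<pi> \<in> perms N\<close>, of j] that \<open>\<pi> \<in> perms N\<close> restr_perms[OF \<open>\<pi> \<in> perms N\<close>]
        perms_length[of "restr \<pi> j" N] by (auto simp: L_def)
    then show ?thesis using wins_antichain_iff[OF mL that] i by auto
  qed
  have wB: "wins N B \<pi> \<longleftrightarrow> \<pi> ! (i - 1) = N \<and> restr \<pi> i = p \<or> \<pi> ! (N - 1) = N \<and> restr \<pi> i \<noteq> p"
    if "\<pi> \<in> perms N" for \<pi>
  proof -
    \<comment> \<open>The prefix \<open>restr \<pi> j\<close> has size \<open>j\<close>, so it can
      equal \<open>p\<close> only for \<open>j = i\<close> and be a leaf only for
      \<open>j = N\<close>.\<close>
    have "restr \<pi> j \<in> B \<longleftrightarrow> j = i \<and> restr \<pi> i = p \<or> j = N \<and> \<pi> ! (N - 1) = N \<and> restr \<pi> i \<noteq> p"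
      if "j \<in> {1..N}" for j
      using len[OF \<open>\<pi> \<in> perms N\<close>, of j] that \<open>\<pi> \<in> perms N\<close> restr_perms[OF \<open>\<pi> \<in> perms N\<close>]
        contains_restr_iff[OF \<open>\<pi> \<in> perms N\<close>, of p] perms_length[of "restr \<pi> j" N] assms(3) i
      by (auto simp: B_def)
    then show ?thesis using wins_antichain_iff[OF mB that] i by auto
  qed
  have "win_prob N I B = win_prob N I L"
    using assms(1) mL mB unfolding strategy_indifferent_def by blast
  then have "card {\<pi> \<in> I. wins N B \<pi>} = card {\<pi> \<in> I. wins N L \<pi>}"
    using I(1) fin by (simp add: win_prob_eq)
  moreover have "{\<pi> \<in> I. wins N B \<pi>} = {\<pi> \<in> I. \<pi> ! (i - 1) = N \<and> restr \<pi> i = p} \<union>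
      {\<pi> \<in> I. \<pi> ! (N - 1) = N \<and> restr \<pi> i \<noteq> p}"
    using wB I(2) by blast
  moreover have "{\<pi> \<in> I. wins N L \<pi>} = {\<pi> \<in> I. \<pi> ! (N - 1) = N \<and> restr \<pi> i = p} \<union>
      {\<pi> \<in> I. \<pi> ! (N - 1) = N \<and> restr \<pi> i \<noteq> p}"
    using wL I(2) by blast
  moreover have "card ({\<pi> \<in> I. Q \<pi> \<and> restr \<pi> i = p} \<union> {\<pi> \<in> I. \<pi> ! (N - 1) = N \<and> restr \<pi> i \<noteq> p}) =
      card {\<pi> \<in> I. Q \<pi> \<and> restr \<pi> i = p} + card {\<pi> \<in> I. \<pi> ! (N - 1) = N \<and> restr \<pi> i \<noteq> p}" for Q
    by (rule card_Un_disjoint) (use fin in auto)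
  ultimately show ?thesis by simp
qed simp

lemma card_eq_sum_fibres:
  assumes "finite S" "finite P" "f ` S \<subseteq> P"
  shows "card S = (\<Sum>p\<in>P. card {x \<in> S. f x = p})"
  unfolding card_eq_sum by (rule sum.group[OF assms, symmetric])

text \<open>Sum the previous count over all eligible prefixes of size \<open>i\<close>. On the left
  nothing is lost, since \<open>N\<close> at position \<open>i\<close> makes the prefix eligible; on
  the right, \<open>lr_max \<pi> i\<close> expresses exactly this eligibility.\<close>

lemma strategy_indifferent_position_count:
  assumes "strategy_indifferent N I" "i \<in> {1..N}"
  shows "card {\<pi> \<in> I. \<pi> ! (i - 1) = N} = card {\<pi> \<in> I. \<pi> ! (N - 1) = N \<and> lr_max \<pi> i}"
proof -
  have I: "I \<subseteq> perms N" using assms(1) by (simp add: strategy_indifferent_def)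
  have fin: "finite I" using I by (rule finite_subset) simp
  define P where "P = {p \<in> prefix_tree N. length p = i}"
  have "P \<subseteq> perms i" by (auto simp: P_def prefix_tree_iff)
  then have finP: "finite P" by (rule finite_subset) simp
  have mem: "restr \<pi> i \<in> P \<longleftrightarrow> lr_max \<pi> i" if "\<pi> \<in> I" for \<pi>
    using that I restr_in_prefix_tree_iff[of \<pi> N i] restr_length[of \<pi> i] assms(2)
      perms_distinct[of \<pi> N] perms_length[of \<pi> N] by (auto simp: P_def)
  have "card {\<pi> \<in> I. \<pi> ! (i - 1) = N} = (\<Sum>p\<in>P. card {\<pi> \<in> {\<pi> \<in> I. \<pi> ! (i - 1) = N}. restr \<pi> i = p})"
    by (rule card_eq_sum_fibres) (use fin finP mem lr_max_of_max I assms(2) in auto)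
  also have "\<dots> = (\<Sum>p\<in>P. card {\<pi> \<in> {\<pi> \<in> I. \<pi> ! (N - 1) = N \<and> lr_max \<pi> i}. restr \<pi> i = p})"
  proof (rule sum.cong[OF refl])
    fix p assume p: "p \<in> P"
    have "{\<pi> \<in> {\<pi> \<in> I. \<pi> ! (N - 1) = N \<and> lr_max \<pi> i}. restr \<pi> i = p} =
        {\<pi> \<in> I. \<pi> ! (N - 1) = N \<and> restr \<pi> i = p}"
      using mem p by blast
    then show "card {\<pi> \<in> {\<pi> \<in> I. \<pi> ! (i - 1) = N}. restr \<pi> i = p} =
        card {\<pi> \<in> {\<pi> \<in> I. \<pi> ! (N - 1) = N \<and> lr_max \<pi> i}. restr \<pi> i = p}"
      using strategy_indifferent_prefix_count[OF assms(1), of p i] p by (simp add: P_def conj_assoc)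
  qed
  also have "\<dots> = card {\<pi> \<in> I. \<pi> ! (N - 1) = N \<and> lr_max \<pi> i}"
    by (rule card_eq_sum_fibres[symmetric]) (use fin finP mem in auto)
  finally show ?thesis .
qed

lemma strategy_indifferent_card_le:
  assumes "strategy_indifferent N I" "N \<ge> 1"
  shows "real (card I) \<le> fact (N - 1) * (1 + (\<Sum>i=1..N-1. 1 / real i))"
proof -
  have I: "I \<subseteq> perms N" using assms(1) by (simp add: strategy_indifferent_def)
  have fin: "finite I" using I by (rule finite_subset) simp
  define L where "L = {\<pi> \<in> perms N. \<pi> ! (N - 1) = N}"
  have finL: "finite L" by (simp add: L_def)
  have lr_sub: "{i. lr_max \<pi> i} = {i \<in> {1..N}. lr_max \<pi> i}" if "\<pi> \<in> L" for \<pi>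
    using that perms_length by (auto simp: L_def lr_max_def)
  have "I \<subseteq> (\<Union>i\<in>{1..N}. {\<pi> \<in> I. \<pi> ! (i - 1) = N})"
  proof
    fix \<pi> assume \<pi>: "\<pi> \<in> I"
    then have "N \<in> set \<pi>" using I assms(2) by (auto simp: permutations_of_set_def)
    then obtain k where "k < N" "\<pi> ! k = N"
      using perms_length[of \<pi> N] \<pi> I by (auto simp: in_set_conv_nth)
    then show "\<pi> \<in> (\<Union>i\<in>{1..N}. {\<pi> \<in> I. \<pi> ! (i - 1) = N})"
      using \<pi> by (intro UN_I[of "k + 1"]) auto
  qed
  then have "card I \<le> card (\<Union>i\<in>{1..N}. {\<pi> \<in> I. \<pi> ! (i - 1) = N})"
    by (rule card_mono[rotated]) (use fin in auto)
  also have "\<dots> \<le> (\<Sum>i=1..N. card {\<pi> \<in> I. \<pi> ! (i - 1) = N})"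
    by (rule card_UN_le) simp
  also have "\<dots> = (\<Sum>i=1..N. card {\<pi> \<in> I. \<pi> ! (N - 1) = N \<and> lr_max \<pi> i})"
    by (rule sum.cong[OF refl]) (rule strategy_indifferent_position_count[OF assms(1)])
  \<comment> \<open>The leaves in \<open>I\<close> are enlarged to all leaves; the next step counts
    the pairs of a leaf and one of its left-to-right maxima the other way round.\<close>
  also have "\<dots> \<le> (\<Sum>i=1..N. card {\<pi> \<in> L. lr_max \<pi> i})"
    by (intro sum_mono card_mono) (use finL I in \<open>auto simp: L_def\<close>)
  also have "\<dots> = (\<Sum>\<pi>\<in>L. card {i. lr_max \<pi> i})"
    using sum.swap_restrict[of "{1..N}" L "\<lambda>_ _. 1::nat" "\<lambda>i \<pi>. lr_max \<pi> i"] finL lr_sub by simp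
  also have "\<dots> = (\<Sum>\<tau>\<in>perms (N - 1). card {i. lr_max (\<tau> @ [N]) i})"
    unfolding L_def leaves_eq[OF assms(2)] by (subst sum.reindex) (auto simp: inj_on_def)
  finally have "real (card I) \<le> real (\<Sum>\<tau>\<in>perms (N - 1). card {i. lr_max (\<tau> @ [N]) i})"
    by (simp only: of_nat_le_iff)
  then show ?thesis using sum_card_lr_max_leaves[OF assms(2)] by simp
qed

subsection \<open>The extremal set\<close>

text \<open>The position of \<open>N\<close> recovers \<open>i\<close> and deleting \<open>N\<close>
  recovers \<open>\<tau>\<close>, so an insertion determines both of its ingredients.\<close>

lemma insert_at_max:
  assumes "\<tau> \<in> perms (N - 1)" "N \<ge> 1" "i \<in> {1..N}"
  shows "insert_at i N \<tau> \<in> perms N" "j < N \<Longrightarrow> insert_at i N \<tau> ! j = N \<longleftrightarrow> j = i - 1"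
    "remove1 N (insert_at i N \<tau>) = \<tau>"
proof -
  have t: "set \<tau> = {1..N-1}" "distinct \<tau>" "length \<tau> = N - 1"
    using assms(1) perms_length[OF assms(1)] by (auto simp: permutations_of_set_def)
  have N: "N \<notin> set \<tau>" using t(1) assms(2) by auto
  have s: "set (take (i - 1) \<tau>) \<union> set (drop (i - 1) \<tau>) = {1..N-1}"
    using t(1) by (metis append_take_drop_id set_append)
  have "set (insert_at i N \<tau>) = insert N {1..N-1}"
    using s by (auto simp: insert_at_def)
  moreover have "insert N {1..N-1} = {1..N}" using assms(2) by auto
  moreover have d: "distinct (insert_at i N \<tau>)"
    using t(2) N set_take_disj_set_drop_if_distinct[of \<tau> "i - 1" "i - 1"]
    by (auto simp: insert_at_def dest: in_set_takeD in_set_dropD)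
  ultimately show perm: "insert_at i N \<tau> \<in> perms N" by (simp add: permutations_of_set_def)
  have at: "insert_at i N \<tau> ! (i - 1) = N"
  proof -
    have "length (take (i - 1) \<tau>) = i - 1" using assms(3) t(3) by auto
    then show ?thesis unfolding insert_at_def by (metis append_Cons nth_append_length)
  qed
  show "insert_at i N \<tau> ! j = N \<longleftrightarrow> j = i - 1" if "j < N"
    using nth_eq_iff_index_eq[OF d, of j "i - 1"] at that assms(3) perms_length[OF perm] by auto
  have "N \<notin> set (take (i - 1) \<tau>)" using N in_set_takeD by metis
  then show "remove1 N (insert_at i N \<tau>) = \<tau>"
    by (simp add: insert_at_def remove1_append)
qed

text \<open>The two sequences being flattened share their first \<open>i - 1\<close> entries. Their
  last entries, \<open>N\<close> and the \<open>i\<close>-th entry of the leaf, may differ, but each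
  exceeds all the shared ones, so the relative order is the same.\<close>

lemma restr_insert_at:
  assumes "\<tau> \<in> perms (N - 1)" "N \<ge> 1" "lr_max (\<tau> @ [N]) i"
  shows "restr (insert_at i N \<tau>) i = restr (\<tau> @ [N]) i"
proof -
  have len: "length \<tau> = N - 1" using perms_length[OF assms(1)] .
  have i: "1 \<le> i" "i \<le> N" using assms(2,3) len by (auto simp: lr_max_def)
  define ys where "ys = take (i - 1) \<tau>"
  \<comment> \<open>Reading the entry from \<open>\<tau> @ [N]\<close> instead of
    \<open>\<tau>\<close> covers \<open>i = N\<close>, where it is \<open>N\<close> itself.\<close>
  define x where "x = (\<tau> @ [N]) ! (i - 1)"
  have leny: "length ys = i - 1" using i len by (simp add: ys_def)
  have "take i (\<tau> @ [N]) = take (i - 1) (\<tau> @ [N]) @ [x]"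
    using take_Suc_conv_app_nth[of "i - 1" "\<tau> @ [N]"] i len by (simp add: x_def)
  then have 2: "take i (\<tau> @ [N]) = ys @ [x]" using i len by (simp add: ys_def)
  have 1: "take i (insert_at i N \<tau>) = ys @ [N]"
    using i len by (simp add: insert_at_def ys_def)
  have ltx: "ys ! k < x" if "k < i - 1" for k
  proof -
    have "k + 1 \<in> {1..<i}" using that by auto
    then have "(\<tau> @ [N]) ! (k + 1 - 1) < x" using assms(3) unfolding lr_max_def x_def by blast
    moreover have "k < length \<tau>" using that i len by simp
    ultimately show ?thesis using that by (simp add: ys_def nth_append)
  qed
  have ltN: "ys ! k < N" if "k < i - 1" for k
  proof -
    have "k < N - 1" using that i by simp
    then have "\<tau> ! k < N" using perms_nth[OF assms(1), of k] by auto
    then show ?thesis using that by (simp add: ys_def)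
  qed
  have perm: "insert_at i N \<tau> \<in> perms N"
    using insert_at_max(1)[OF assms(1,2)] i by simp
  have dl: "distinct (\<tau> @ [N])"
    using assms(1,2) by (auto simp: permutations_of_set_def)
  show ?thesis
    unfolding restr_def
  proof (rule flatten_cong)
    show "distinct (take i (insert_at i N \<tau>))" using perms_distinct[OF perm] distinct_take by blast
    show "distinct (take i (\<tau> @ [N]))" using dl distinct_take by blast
    fix k l assume "k < length (take i (insert_at i N \<tau>))" "l < length (take i (insert_at i N \<tau>))"
    then have "k \<le> i - 1" "l \<le> i - 1" using 1 leny by auto
    then show "take i (insert_at i N \<tau>) ! k < take i (insert_at i N \<tau>) ! l \<longleftrightarrow>
        take i (\<tau> @ [N]) ! k < take i (\<tau> @ [N]) ! l"
      unfolding 1 2 using ltx[of k] ltx[of l] ltN[of k] ltN[of l] leny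
      by (auto simp: nth_append)
  qed (simp only: 1 2 length_append list.size)
qed

lemma lr_max_leaf_range:
  assumes "\<tau> \<in> perms (N - 1)" "N \<ge> 1" "lr_max (\<tau> @ [N]) i"
  shows "i \<in> {1..N}"
  using assms perms_length[OF assms(1)] by (auto simp: lr_max_def)

text \<open>Parametrising by pairs lets the cardinality be computed as a sum over
  \<open>\<tau>\<close> of the number of left-to-right maxima of its leaf.\<close>

lemma extremal_set_eq:
  assumes "N \<ge> 1"
  shows "extremal_set N =
    (\<lambda>(\<tau>, i). insert_at i N \<tau>) ` (SIGMA \<tau>:perms (N - 1). {i. lr_max (\<tau> @ [N]) i})"
proof -
  have "extremal_set N = {insert_at i N \<tau> | i \<tau>. \<tau> \<in> perms (N - 1) \<and> lr_max (\<tau> @ [N]) i}"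
    unfolding extremal_set_def by (simp only: lr_max_leaf_iff[OF _ assms] cong: conj_cong)
  also have "\<dots> = (\<lambda>(\<tau>, i). insert_at i N \<tau>) ` (SIGMA \<tau>:perms (N - 1). {i. lr_max (\<tau> @ [N]) i})"
    unfolding image_def Bex_def split_paired_Ex mem_Sigma_iff mem_Collect_eq prod.case by blast
  finally show ?thesis .
qed

lemma extremal_set_subset:
  assumes "N \<ge> 1"
  shows "extremal_set N \<subseteq> perms N"
  unfolding extremal_set_eq[OF assms]
proof (rule image_subsetI, clarify)
  fix \<tau> i assume t: "\<tau> \<in> perms (N - 1)" "lr_max (\<tau> @ [N]) i"
  show "insert_at i N \<tau> \<in> perms N"
    by (rule insert_at_max(1)[OF t(1) assms lr_max_leaf_range[OF t(1) assms t(2)]])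
qed

lemma card_extremal_set:
  assumes "N \<ge> 1"
  shows "real (card (extremal_set N)) = fact (N - 1) * (1 + (\<Sum>i=1..N-1. 1 / real i))"
proof -
  have "inj_on (\<lambda>(\<tau>, i). insert_at i N \<tau>) (SIGMA \<tau>:perms (N - 1). {i. lr_max (\<tau> @ [N]) i})"
  proof (rule inj_onI)
    fix a b
    assume "a \<in> (SIGMA \<tau>:perms (N - 1). {i. lr_max (\<tau> @ [N]) i})"
      "b \<in> (SIGMA \<tau>:perms (N - 1). {i. lr_max (\<tau> @ [N]) i})"
      and "(\<lambda>(\<tau>, i). insert_at i N \<tau>) a = (\<lambda>(\<tau>, i). insert_at i N \<tau>) b"
    then obtain \<tau> i \<tau>' i' where ab: "a = (\<tau>, i)" "b = (\<tau>', i')"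
      and t: "\<tau> \<in> perms (N - 1)" "\<tau>' \<in> perms (N - 1)" "lr_max (\<tau> @ [N]) i" "lr_max (\<tau>' @ [N]) i'"
      and eq: "insert_at i N \<tau> = insert_at i' N \<tau>'"
      by (cases a, cases b) simp
    have i: "i \<in> {1..N}" "i' \<in> {1..N}" using lr_max_leaf_range assms t by blast+
    \<comment> \<open>Both sides are the index of \<open>N\<close> in the common list. Since
      \<open>i\<close> and \<open>i'\<close> are at least 1, the truncated subtraction loses
      nothing.\<close>
    have "i' - 1 = i - 1"
      using insert_at_max(2)[OF t(1) assms i(1), of "i' - 1"]
        insert_at_max(2)[OF t(2) assms i(2), of "i' - 1"] i eq by auto
    moreover have "\<tau> = \<tau>'"
      using insert_at_max(3)[OF t(1) assms i(1)] insert_at_max(3)[OF t(2) assms i(2)] eq by simp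
    ultimately show "a = b" using i ab by auto
  qed
  then have "card (extremal_set N) = (\<Sum>\<tau>\<in>perms (N - 1). card {i. lr_max (\<tau> @ [N]) i})"
    by (simp add: extremal_set_eq[OF assms] card_image finite_lr_max)
  then show ?thesis using sum_card_lr_max_leaves[OF assms] by simp
qed

text \<open>Maximality gives an element of \<open>A\<close> comparable with \<open>w\<close>;
  nothing in the tree properly contains a leaf, so that element is a prefix of \<open>w\<close>. Two
  such prefixes would be comparable, which the antichain condition forbids.\<close>

lemma leaf_meets_antichain_once:
  assumes "maximal_antichain N A" "w \<in> perms N" "w ! (N - 1) = N" "N \<ge> 1"
  shows "\<exists>!p. p \<in> A \<and> contains w p"
proof -
  have sub: "A \<subseteq> prefix_tree N" using assms(1) by (simp add: maximal_antichain_def)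
  have "w \<in> prefix_tree N" using leaf_iff assms by blast
  then obtain p where p: "p \<in> A" "contains w p \<or> contains p w"
    using assms(1) unfolding maximal_antichain_def by blast
  have "contains w p"
  proof (cases "contains w p")
    case False
    then have c: "contains p w" using p by blast
    have pp: "p \<in> perms (length p)" "length p \<le> N" using p(1) sub by (auto simp: prefix_tree_iff)
    then have "length p = N" using c perms_length[OF assms(2)] by (simp add: contains_def)
    then have "p = w"
      using c pp(1) perms_length[OF assms(2)] restr_perms[of p N] by (simp add: contains_def)
    then show ?thesis using c by simp
  qed
  moreover have "q = p" if "q \<in> A" "contains w q" "contains w p" for q
    using contains_common[OF perms_distinct[OF assms(2)] that(2,3)] that(1) p(1) assms(1)
    unfolding maximal_antichain_def by blast
  ultimately show ?thesis using p(1) by blast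
qed

lemma card_extremal_wins:
  assumes "maximal_antichain N A" "N \<ge> 1"
  shows "card {\<pi> \<in> extremal_set N. wins N A \<pi>} = fact (N - 1)"
proof -
  have sub: "A \<subseteq> prefix_tree N" using assms(1) by (simp add: maximal_antichain_def)
  \<comment> \<open>\<open>k \<tau>\<close> will be the only admissible position at which inserting
    \<open>N\<close> into \<open>\<tau>\<close> makes \<open>A\<close> win.\<close>
  define k where "k = (\<lambda>\<tau>. length (THE p. p \<in> A \<and> contains (\<tau> @ [N]) p))"
  have leaf: "\<tau> @ [N] \<in> perms N" "(\<tau> @ [N]) ! (N - 1) = N" if "\<tau> \<in> perms (N - 1)" for \<tau>
    using leaves_eq[OF assms(2)] that by blast+
  \<comment> \<open>A win must stop at position \<open>i\<close>, the only place of
    \<open>N\<close>, and there the visible prefix is the one of the leaf by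
    \<open>restr_insert_at\<close>.\<close>
  have wins_iff: "wins N A (insert_at i N \<tau>) \<longleftrightarrow> restr (\<tau> @ [N]) i \<in> A"
    if t: "\<tau> \<in> perms (N - 1)" "lr_max (\<tau> @ [N]) i" for \<tau> i
  proof -
    have i: "i \<in> {1..N}" using lr_max_leaf_range[OF t(1) assms(2) t(2)] .
    have "insert_at i N \<tau> ! (j - 1) = N \<longleftrightarrow> j = i" if "j \<in> {1..N}" for j
    proof -
      have "j - 1 < N" "j - 1 = i - 1 \<longleftrightarrow> j = i" using that i by auto
      then show ?thesis using insert_at_max(2)[OF t(1) assms(2) i] by simp
    qed
    then show ?thesis
      using wins_antichain_iff[OF assms(1) insert_at_max(1)[OF t(1) assms(2) i]] i
        restr_insert_at[OF t(1) assms(2) t(2)] by auto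
  qed
  have k_iff: "lr_max (\<tau> @ [N]) i \<and> restr (\<tau> @ [N]) i \<in> A \<longleftrightarrow> i = k \<tau>"
    if t: "\<tau> \<in> perms (N - 1)" for \<tau> i
  proof -
    note l = leaf[OF t]
    have len: "length (\<tau> @ [N]) = N" using perms_length[OF l(1)] .
    have ex: "\<exists>!p. p \<in> A \<and> contains (\<tau> @ [N]) p"
      using leaf_meets_antichain_once[OF assms(1) l assms(2)] .
    then obtain p where p: "p \<in> A" "contains (\<tau> @ [N]) p" by blast
    have "(THE p. p \<in> A \<and> contains (\<tau> @ [N]) p) = p"
      using ex p by (blast intro: the1_equality)
    then have kp: "k \<tau> = length p" by (simp add: k_def)
    show ?thesis
    proof
      assume a: "lr_max (\<tau> @ [N]) i \<and> restr (\<tau> @ [N]) i \<in> A"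
      then have i: "i \<in> {1..N}" using lr_max_leaf_range[OF t assms(2)] by blast
      have ri: "length (restr (\<tau> @ [N]) i) = i"
        using restr_length[OF perms_distinct[OF l(1)], of i] len i by simp
      then have "contains (\<tau> @ [N]) (restr (\<tau> @ [N]) i)"
        using i len by (simp add: contains_def)
      then have "restr (\<tau> @ [N]) i = p" using ex p a by blast
      then show "i = k \<tau>" using ri kp by simp
    next
      assume i: "i = k \<tau>"
      have "p \<in> prefix_tree N" using p(1) sub by blast
      moreover have "restr (\<tau> @ [N]) i = p" "i \<in> {1..N}"
        using p(2) i kp \<open>p \<in> prefix_tree N\<close> by (auto simp: contains_def prefix_tree_iff)
      ultimately show "lr_max (\<tau> @ [N]) i \<and> restr (\<tau> @ [N]) i \<in> A"
        using restr_in_prefix_tree_iff[OF l(1), of i] p(1) by simp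
    qed
  qed
  \<comment> \<open>The winning elements are thus parametrised by \<open>\<tau>\<close> alone.
    Deleting \<open>N\<close> inverts the parametrisation, so their number does not depend on
    \<open>A\<close>.\<close>
  have "{\<pi> \<in> extremal_set N. wins N A \<pi>} = (\<lambda>\<tau>. insert_at (k \<tau>) N \<tau>) ` perms (N - 1)"
  proof (intro equalityI subsetI)
    fix \<pi> assume "\<pi> \<in> {\<pi> \<in> extremal_set N. wins N A \<pi>}"
    then obtain \<tau> i where t: "\<tau> \<in> perms (N - 1)" "lr_max (\<tau> @ [N]) i" "\<pi> = insert_at i N \<tau>"
      and "wins N A \<pi>"
      unfolding extremal_set_eq[OF assms(2)] by auto
    then have "i = k \<tau>" using wins_iff k_iff by blast
    then show "\<pi> \<in> (\<lambda>\<tau>. insert_at (k \<tau>) N \<tau>) ` perms (N - 1)" using t by blast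
  next
    fix \<pi> assume "\<pi> \<in> (\<lambda>\<tau>. insert_at (k \<tau>) N \<tau>) ` perms (N - 1)"
    then obtain \<tau> where t: "\<tau> \<in> perms (N - 1)" "\<pi> = insert_at (k \<tau>) N \<tau>" by blast
    then have "lr_max (\<tau> @ [N]) (k \<tau>)" "wins N A \<pi>" using k_iff wins_iff by blast+
    then show "\<pi> \<in> {\<pi> \<in> extremal_set N. wins N A \<pi>}"
      unfolding extremal_set_eq[OF assms(2)] using t by auto
  qed
  moreover have "inj_on (\<lambda>\<tau>. insert_at (k \<tau>) N \<tau>) (perms (N - 1))"
  proof (rule inj_on_inverseI[where g = "remove1 N"])
    fix \<tau> assume t: "\<tau> \<in> perms (N - 1)"
    then have "k \<tau> \<in> {1..N}" using k_iff lr_max_leaf_range assms(2) by blast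
    then show "remove1 N (insert_at (k \<tau>) N \<tau>) = \<tau>" using insert_at_max(3)[OF t assms(2)] by blast
  qed
  ultimately show ?thesis by (simp add: card_image)
qed

lemma extremal_set_strategy_indifferent:
  assumes "N \<ge> 1"
  shows "strategy_indifferent N (extremal_set N)"
proof -
  have sub: "extremal_set N \<subseteq> perms N" using extremal_set_subset[OF assms] .
  have fin: "finite (extremal_set N)" using sub by (rule finite_subset) simp
  have "real (card (extremal_set N)) > 0"
    unfolding card_extremal_set[OF assms] by (intro mult_pos_pos add_pos_nonneg sum_nonneg) auto
  then have ne: "extremal_set N \<noteq> {}" by auto
  show ?thesis
    unfolding strategy_indifferent_def
    using sub ne by (simp add: win_prob_eq[OF fin ne] card_extremal_wins[OF _ assms])
qed

theorem mainTheorem7: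
  fixes N :: nat
  assumes "N \<ge> 1"
  shows "(\<forall>I. strategy_indifferent N I \<longrightarrow>
            real (card I) \<le> fact (N - 1) * (1 + (\<Sum>i = 1..N - 1. 1 / real i)))
       \<and> strategy_indifferent N (extremal_set N)
       \<and> real (card (extremal_set N)) = fact (N - 1) * (1 + (\<Sum>i = 1..N - 1. 1 / real i))"
  using assms strategy_indifferent_card_le extremal_set_strategy_indifferent card_extremal_set
  by blast

end
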